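(* If $n\ge 4$ is even, there is no convex $n$-gon $P\subset\mathbb{R}^2$ (a $2$-dimensional convex polytope with $n$ vertices) satisfying $P=-P^\circ$.
   Context: For $A\subseteq\mathbb{R}^d$, the polar is $A^\circ=\{x\in\mathbb{R}^d:\langle x,a\rangle\le 1\text{ for all }a\in A\}$, and $-A=\{-a:a\in A\}$. *)

theory Defs
  imports "HOL-Analysis.Analysis"
begin

definition polar :: "'a::real_inner set \<Rightarrow> 'a set"
  where "polar A = {x. \<forall>a\<in>A. inner x a \<le> 1}"

text \<open>A full-dimensional polytope; \<open>aff_dim P = 2\<close> excludes points and segments. The vertices
  are the extreme points, so degenerate (straight-angle) corners do not count.\<close>

definition convex_ngon :: "nat \<Rightarrow> (real ^ 2) set \<Rightarrow> bool"
  where "convex_ngon n P \<longleftrightarrow>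
    polytope P \<and> aff_dim P = 2 \<and> card {v. v extreme_point_of P} = n"

end

theory Submission
  imports Defs
begin

text \<open>Call vertices \<open>v\<close>, \<open>w\<close> of \<open>P = - P\<degree>\<close> adjacent if \<open>v \<bullet> w = -1\<close>, the least value an inner product
  of two points of \<open>P\<close> can take. Since \<open>v\<close> is an extreme point of
  \<open>P = {x. x \<bullet> w \<ge> -1 for all vertices w}\<close>, at least two constraints are tight at \<open>v\<close>; three vertices
  tight at \<open>v\<close> would be collinear. So the adjacency graph is 2-regular. Moreover any two disjoint edges
  cross, in the sense that the cone spanned by one edge contains exactly one end of the other one.
  Hence, given an edge \<open>{v, w}\<close>, all edges disjoint from it join its two sides, and the remaining
  neighbours of \<open>v\<close> and \<open>w\<close> lie on the same side; counting degrees, the sizes of the two sides differ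
  by exactly one, so the number of vertices is odd.\<close>

section \<open>Parity of a 2-regular graph by counting edges across one edge\<close>

text \<open>The predicate \<open>C\<close> abstracts which side of the fixed edge
  \<open>{v, w}\<close> a vertex lies on. Apart from the edges at \<open>v\<close> and
  \<open>w\<close>, every edge joins the two sides, so the degree sums of the sides differ only by
  the two edges that leave \<open>{v, w}\<close>, and both of these end on one side.\<close>

lemma odd_card_two_regular:
  fixes E :: "'a \<Rightarrow> 'a \<Rightarrow> bool"
  assumes fin: "finite V" and sym: "\<And>a b. E a b \<Longrightarrow> E b a" and irr: "\<And>a. \<not> E a a"
    and reg: "\<And>a. a \<in> V \<Longrightarrow> card {b \<in> V. E a b} = 2"
    and vw: "v \<in> V" "w \<in> V" "E v w"
    and cross: "\<And>a b. a \<in> V - {v, w} \<Longrightarrow> b \<in> V - {v, w} \<Longrightarrow> E a b \<Longrightarrow> C a \<longleftrightarrow> \<not> C b"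
    and side: "\<And>a b. a \<in> V - {v, w} \<Longrightarrow> b \<in> V - {v, w} \<Longrightarrow> E v a \<Longrightarrow> E w b \<Longrightarrow> C a \<longleftrightarrow> C b"
  shows "odd (card V)"
proof -
  have other: "\<exists>y. y \<in> V - {x, z} \<and> {b \<in> V. E x b} = {z, y}" if "x \<in> V" "z \<in> V" "E x z" for x z
  proof -
    obtain p q where pq: "{b \<in> V. E x b} = {p, q}" "p \<noteq> q"
      using reg[OF \<open>x \<in> V\<close>] by (auto simp: card_2_iff)
    have "z \<in> {p, q}" "x \<notin> {p, q}" "{p, q} \<subseteq> V"
      using that irr by (auto simp flip: pq(1))
    then consider "z = p" "q \<in> V - {x, z}" | "z = q" "p \<in> V - {x, z}"
      using pq(2) by auto
    then show ?thesis
      using pq(1) by cases (metis, metis insert_commute)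
  qed
  obtain v' where v': "v' \<in> V - {v, w}" "{b \<in> V. E v b} = {w, v'}"
    using other[OF vw] by blast
  obtain w' where w': "w' \<in> V - {w, v}" "{b \<in> V. E w b} = {v, w'}"
    using other[OF vw(2,1) sym[OF vw(3)]] by blast
  have same: "C v' \<longleftrightarrow> C w'"
    using side[of v' w'] v' w' by blast
  define L where "L = {a \<in> V - {v, w}. C a}"
  define R where "R = {a \<in> V - {v, w}. \<not> C a}"
  have finLR: "finite L" "finite R" using fin by (auto simp: L_def R_def)
  have E_commute: "E a b = E b a" for a b using sym by blast
  \<comment> \<open>\<open>m A B\<close> counts the pairs in \<open>A\<close> times \<open>B\<close>
    that are edges; \<open>m_sym\<close> is double counting.\<close>
  define m where "m A B = (\<Sum>a\<in>A. card {b \<in> B. E a b})" for A B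
  have m_sym: "m A B = m B A" if "finite A" "finite B" for A B
  proof -
    have "m A B = (\<Sum>a\<in>A. \<Sum>b\<in>B. of_bool (E a b))"
      unfolding m_def using that by (simp add: Int_def)
    also have "\<dots> = (\<Sum>b\<in>B. \<Sum>a\<in>A. of_bool (E b a))"
      by (subst sum.swap) (simp only: E_commute)
    also have "\<dots> = m B A"
      unfolding m_def using that by (simp add: Int_def)
    finally show ?thesis .
  qed
  have vw_ne: "v \<noteq> w" using vw irr by blast
  \<comment> \<open>The degree sum of one side \<open>A\<close>: each neighbour lies in the opposite
    side \<open>B\<close> or in \<open>{v, w}\<close>.\<close>
  have deg: "2 * card A = m A B + m {v, w} A"
    if A: "A \<subseteq> V - {v, w}" and B: "B \<subseteq> V - {v, w}"
      and nb: "\<And>a b. a \<in> A \<Longrightarrow> b \<in> V - {v, w} \<Longrightarrow> E a b \<Longrightarrow> b \<in> B" for A B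
  proof -
    have fins: "finite A" "finite B" using A B fin by (auto intro: finite_subset)
    have "2 * card A = (\<Sum>a\<in>A. card {b \<in> V. E a b})"
      using reg A by (subst sum.cong[OF refl, of _ _ "\<lambda>_. 2"]) auto
    also have "\<dots> = (\<Sum>a\<in>A. card {b \<in> B. E a b} + card {b \<in> {v, w}. E a b})"
    proof (rule sum.cong[OF refl])
      fix a assume "a \<in> A"
      then have "{b \<in> V. E a b} = {b \<in> B. E a b} \<union> {b \<in> {v, w}. E a b}"
        using nb B vw by auto
      moreover have "{b \<in> B. E a b} \<inter> {b \<in> {v, w}. E a b} = {}" using B by auto
      ultimately show "card {b \<in> V. E a b} = card {b \<in> B. E a b} + card {b \<in> {v, w}. E a b}"
        using fins by (simp add: card_Un_disjoint)
    qed
    also have "\<dots> = m A B + m A {v, w}" by (simp add: m_def sum.distrib)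
    finally show ?thesis using m_sym[of A "{v, w}"] fins by simp
  qed
  have degL: "2 * card L = m L R + m {v, w} L"
    using cross by (intro deg) (auto simp: L_def R_def)
  have degR: "2 * card R = m R L + m {v, w} R"
    using cross by (intro deg) (auto simp: L_def R_def)
  have out: "card {b \<in> A. E v b} = of_bool (v' \<in> A)" "card {b \<in> A. E w b} = of_bool (w' \<in> A)"
    if "A \<subseteq> V - {v, w}" for A
  proof -
    have "{b \<in> A. E v b} = A \<inter> {w, v'}" "{b \<in> A. E w b} = A \<inter> {v, w'}"
      using that by (auto simp flip: v'(2) w'(2))
    moreover have "A \<inter> {w, v'} = (if v' \<in> A then {v'} else {})"
      "A \<inter> {v, w'} = (if w' \<in> A then {w'} else {})"
      using that by auto
    ultimately show "card {b \<in> A. E v b} = of_bool (v' \<in> A)" "card {b \<in> A. E w b} = of_bool (w' \<in> A)"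
      by simp_all
  qed
  have m_vw: "m {v, w} A = of_bool (v' \<in> A) + of_bool (w' \<in> A)" if "A \<subseteq> V - {v, w}" for A
    using vw_ne out[OF that] by (simp add: m_def)
  have "v' \<in> L \<longleftrightarrow> C v'" "w' \<in> L \<longleftrightarrow> C v'" "v' \<in> R \<longleftrightarrow> \<not> C v'" "w' \<in> R \<longleftrightarrow> \<not> C v'"
    using v'(1) w'(1) same unfolding L_def R_def by blast+
  moreover have "L \<subseteq> V - {v, w}" "R \<subseteq> V - {v, w}" by (auto simp: L_def R_def)
  ultimately have "m {v, w} L = 2 * of_bool (C v')" "m {v, w} R = 2 * of_bool (\<not> C v')"
    by (simp_all add: m_vw)
  \<comment> \<open>The cross terms \<open>m L R\<close> and \<open>m R L\<close> cancel; the side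
    containing \<open>v'\<close> and \<open>w'\<close> is larger by one.\<close>
  then have "card L + of_bool (\<not> C v') = card R + of_bool (C v')"
    using degL degR m_sym[OF finLR] by simp
  moreover have "card V = card L + card R + 2"
  proof -
    have "V = L \<union> R \<union> {v, w}" "L \<inter> R = {}" "(L \<union> R) \<inter> {v, w} = {}"
      using vw by (auto simp: L_def R_def)
    then have "card V = card (L \<union> R) + card {v, w}" "card (L \<union> R) = card L + card R"
      using finLR card_Un_disjoint[of "L \<union> R" "{v, w}"] card_Un_disjoint[of L R] by simp_all
    then show ?thesis using vw_ne by simp
  qed
  ultimately have "card V = 2 * card R + 3 \<or> card V = 2 * card L + 3"
    by (cases "C v'") simp_all
  then show ?thesis by auto
qed

section \<open>The planar determinant and its identities\<close>

definition cross2 :: "real^2 \<Rightarrow> real^2 \<Rightarrow> real"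
  where "cross2 x y = x$1 * y$2 - x$2 * y$1"

lemma cross2_commute: "cross2 y x = - cross2 x y"
  by (simp add: cross2_def)

lemma cross2_self [simp]: "cross2 x x = 0"
  by (simp add: cross2_def)

text \<open>The Binet-Cauchy identity in the plane. If \<open>inner v w = -1\<close> and
  \<open>inner a b = -1\<close>, the left side is \<open>1 - inner v a * inner w b\<close>, so signs
  of determinants decide whether this product exceeds 1.\<close>

lemma inner_mult_diff:
  "inner v w * inner a b - inner v a * inner w b = cross2 v b * cross2 w a"
  by (simp add: cross2_def inner_vec_def sum_2 algebra_simps)

text \<open>Expansion of \<open>a\<close> and \<open>b\<close> in the orthogonal frame formed by
  \<open>w\<close> and its rotation by a right angle; \<open>cross2_via\<close> is its counterpart
  for determinants.\<close>

lemma inner_via: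
  "inner a b * inner w w = inner w a * inner w b + cross2 w a * cross2 w b"
  by (simp add: cross2_def inner_vec_def sum_2 algebra_simps)

lemma cross2_via:
  "cross2 a b * inner w w = inner w a * cross2 w b - cross2 w a * inner w b"
  by (simp add: cross2_def inner_vec_def sum_2 algebra_simps)

text \<open>Cramer's rule for \<open>b\<close> in terms of \<open>v\<close> and \<open>w\<close>,
  paired with \<open>a\<close>.\<close>

lemma cross2_mult_inner:
  "cross2 v w * inner a b = cross2 b w * inner v a + cross2 v b * inner w a"
  by (simp add: cross2_def inner_vec_def sum_2 algebra_simps)

lemma cross2_eq_0_imp_scaleR:
  assumes "v \<noteq> 0" "cross2 v a = 0"
  shows "a = (inner v a / inner v v) *\<^sub>R v"
proof -
  have "inner v v *\<^sub>R a = inner v a *\<^sub>R v"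
    using assms(2) by (auto simp: vec_eq_iff forall_2 cross2_def inner_vec_def sum_2) algebra+
  then have "inverse (inner v v) *\<^sub>R inner v v *\<^sub>R a = inverse (inner v v) *\<^sub>R inner v a *\<^sub>R v"
    by simp
  then show ?thesis using assms(1) by (simp add: divide_inverse mult.commute)
qed

section \<open>Disjoint edges cross\<close>

text \<open>For \<open>cross2 v w > 0\<close> this is the open cone of all positive combinations of
  \<open>v\<close> and \<open>w\<close>.\<close>

definition in_cone :: "real^2 \<Rightarrow> real^2 \<Rightarrow> real^2 \<Rightarrow> bool"
  where "in_cone v w u \<longleftrightarrow> cross2 v u > 0 \<and> cross2 u w > 0"

lemma pos_pos_if_mult_gt_1:
  fixes p s :: real
  assumes "p \<ge> -1" "s \<ge> -1" "p * s > 1"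
  shows "p > 0" "s > 0"
proof -
  have "\<not> p \<le> 0"
  proof
    assume "p \<le> 0"
    then have "s < 0" using assms(3) by (smt (verit) mult_nonpos_nonneg)
    then have "(- p) * (- s) \<le> 1 * 1" using assms \<open>p \<le> 0\<close> by (intro mult_mono) auto
    then show False using assms by simp
  qed
  then show "p > 0" by simp
  then show "s > 0" using assms(3) by (smt (verit) mult_nonneg_nonpos)
qed

text \<open>The Binet-Cauchy identity makes \<open>inner v a\<close> and \<open>inner w a\<close>
  positive. Since \<open>b\<close> is a positive combination of \<open>v\<close> and
  \<open>w\<close>, \<open>inner a b\<close> would be positive too.\<close>

lemma not_both_in_cone:
  assumes vw: "cross2 v w > 0" "inner v w = -1" and ab: "inner a b = -1"
    and ge: "inner v a \<ge> -1" "inner v b \<ge> -1" "inner w a \<ge> -1" "inner w b \<ge> -1"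
    and C: "in_cone v w a" "in_cone v w b"
  shows False
proof -
  have "cross2 v b * cross2 w a < 0" "cross2 v a * cross2 w b < 0"
    using C cross2_commute[of w a] cross2_commute[of w b]
    by (auto simp: in_cone_def mult_less_0_iff)
  then have "inner v a * inner w b > 1" "inner v b * inner w a > 1"
    using inner_mult_diff[of v w a b] inner_mult_diff[of v w b a] vw ab
    by (auto simp: inner_commute)
  then have "inner v a > 0" "inner w a > 0"
    using pos_pos_if_mult_gt_1 ge by blast+
  then have "cross2 v w * inner a b > 0"
    using cross2_mult_inner[of v w a b] C by (simp add: in_cone_def add_pos_pos)
  then show False using vw ab by simp
qed

text \<open>Here \<open>a\<close> lies to the left of \<open>w\<close> and \<open>b\<close> to the
  right of \<open>v\<close>. Binet-Cauchy makes \<open>inner v a\<close> and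
  \<open>inner w b\<close> positive; expanding them at \<open>w\<close> and at \<open>v\<close>
  makes \<open>inner w a\<close> and \<open>inner v b\<close> negative. The product of the latter
  two is then at most 1, which fixes the sign of \<open>cross2 v a * cross2 w b\<close>, but
  expanding these two determinants gives the opposite sign.\<close>

lemma not_opposite_cones:
  assumes vw: "cross2 v w > 0" "inner v w = -1" and ab: "inner a b = -1"
    and ge: "inner v a \<ge> -1" "inner v b \<ge> -1" "inner w a \<ge> -1" "inner w b \<ge> -1"
    and ord: "cross2 w a > 0" "cross2 v b < 0"
  shows False
proof -
  have nz: "inner v v > 0" "inner w w > 0" using vw(2) by auto
  have "cross2 v b * cross2 w a < 0" using ord by (simp add: mult_neg_pos)
  then have ps: "inner v a * inner w b > 1"
    using inner_mult_diff[of v w a b] vw ab by simp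
  then have pos: "inner v a > 0" "inner w b > 0"
    using pos_pos_if_mult_gt_1 ge by blast+
  have wv: "inner w v = -1" "cross2 w v = - cross2 v w"
    using vw by (simp_all add: inner_commute cross2_commute[of v w])
  have "inner v a * inner w w = - inner w a - cross2 v w * cross2 w a"
    using inner_via[of v a w] wv by simp
  moreover have "inner v a * inner w w > 0" "cross2 v w * cross2 w a > 0"
    using pos nz vw ord by simp_all
  ultimately have r: "inner w a < 0" by linarith
  have "inner w b * inner v v = - inner v b + cross2 v w * cross2 v b"
    using inner_via[of w b v] vw by simp
  moreover have "inner w b * inner v v > 0" "cross2 v w * cross2 v b < 0"
    using pos nz vw ord by (simp_all add: mult_pos_neg)
  ultimately have q: "inner v b < 0" by linarith
  have "\<not> inner v b * inner w a > 1"
    using pos_pos_if_mult_gt_1[of "inner v b" "inner w a"] q ge by auto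
  then have qr: "cross2 v a * cross2 w b \<ge> 0"
    using inner_mult_diff[of v w b a] vw ab by (simp add: inner_commute)
  have "cross2 v a * inner w w = - cross2 w a + cross2 v w * inner w a"
    using cross2_via[of v a w] wv by simp
  moreover have "cross2 v w * inner w a < 0" using vw r by (simp add: mult_pos_neg)
  ultimately have va: "cross2 v a < 0" using ord nz by (smt (verit) mult_nonneg_nonneg)
  have "cross2 w b * inner v v = - cross2 v b - cross2 v w * inner v b"
    using cross2_via[of w b v] vw by simp
  moreover have "cross2 v w * inner v b < 0" using vw q by (simp add: mult_pos_neg)
  ultimately have "cross2 w b > 0" using ord nz by (smt (verit) mult_nonpos_nonneg)
  then show False using qr va by (simp add: mult_neg_pos zero_le_mult_iff)
qed

text \<open>Once the opposite position is excluded, in both orders, \<open>a\<close> and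
  \<open>b\<close> lie in one sector next to \<open>w\<close> or in one next to \<open>v\<close>.
  Such a sector is narrower than a right angle, so \<open>inner a b\<close> would be
  positive.\<close>

lemma not_both_outside_cone:
  assumes vw: "cross2 v w > 0" "inner v w = -1" and ab: "inner a b = -1"
    and ge: "inner v a \<ge> -1" "inner v b \<ge> -1" "inner w a \<ge> -1" "inner w b \<ge> -1"
    and out: "cross2 v a < 0 \<or> cross2 w a > 0" "cross2 v b < 0 \<or> cross2 w b > 0"
  shows False
proof -
  have nz: "inner v v > 0" "inner w w > 0" using vw(2) by auto
  have wv: "inner w v = -1" "cross2 w v = - cross2 v w"
    using vw by (simp_all add: inner_commute cross2_commute[of v w])
  have ba: "inner b a = -1" using ab by (simp add: inner_commute)
  have no1: "\<not> (cross2 w a > 0 \<and> cross2 v b < 0)"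
    using not_opposite_cones[OF vw ab ge] by blast
  have no2: "\<not> (cross2 w b > 0 \<and> cross2 v a < 0)"
    using not_opposite_cones[OF vw ba ge(2,1,4,3)] by blast
  \<comment> \<open>Such a \<open>u\<close> lies between \<open>w\<close> and \<open>-v\<close>. As
    \<open>inner v w < 0\<close>, the angle from \<open>v\<close> to \<open>w\<close> is obtuse or
    straight-bound, hence \<open>u\<close> is less than a right angle away from
    \<open>w\<close>.\<close>
  have near_w: "inner w u > 0" if "cross2 w u > 0" "cross2 v u \<ge> 0" for u
  proof -
    have "cross2 v u * inner w w = - cross2 w u + cross2 v w * inner w u"
      using cross2_via[of v u w] wv by simp
    moreover have "cross2 v u * inner w w \<ge> 0" using that nz by simp
    ultimately have "cross2 v w * inner w u > 0" using that by linarith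
    then show ?thesis using vw by (simp add: zero_less_mult_iff)
  qed
  have near_v: "inner v u > 0" if "cross2 v u < 0" "cross2 w u \<le> 0" for u
  proof -
    have "cross2 w u * inner v v = - cross2 v u - cross2 v w * inner v u"
      using cross2_via[of w u v] vw by simp
    moreover have "cross2 w u * inner v v \<le> 0" using that nz by (simp add: mult_nonpos_nonneg)
    ultimately have "cross2 v w * inner v u > 0" using that by linarith
    then show ?thesis using vw by (simp add: zero_less_mult_iff)
  qed
  consider "cross2 w a > 0" "cross2 w b > 0" "cross2 v a \<ge> 0" "cross2 v b \<ge> 0"
    | "cross2 v a < 0" "cross2 v b < 0" "cross2 w a \<le> 0" "cross2 w b \<le> 0"
    using out no1 no2 by linarith
  then have "inner a b * inner w w > 0 \<or> inner a b * inner v v > 0"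
  proof cases
    case 1
    then have "inner w a * inner w b + cross2 w a * cross2 w b > 0"
      using near_w by (simp add: add_pos_pos)
    then show ?thesis using inner_via[of a b w] by simp
  next
    case 2
    then have "inner v a * inner v b + cross2 v a * cross2 v b > 0"
      using near_v by (simp add: add_pos_pos mult_neg_neg)
    then show ?thesis using inner_via[of a b v] by simp
  qed
  then show False using ab nz by (simp add: zero_less_mult_iff)
qed

section \<open>Extreme points, boundary rays and tight constraints\<close>

text \<open>Of two distinct nonzero points on a ray from \<open>0\<close>, the nearer one is inside
  the segment from \<open>0\<close> to the farther one. This keeps other vertices off the boundary
  rays of the open cone of an edge.\<close>

lemma extreme_points_not_on_ray:
  fixes P :: "'a::real_vector set"
  assumes "v extreme_point_of P" "a extreme_point_of P" "0 \<in> P" "a \<noteq> v" "v \<noteq> 0" "c > 0"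
  shows "a \<noteq> c *\<^sub>R v"
proof
  assume a: "a = c *\<^sub>R v"
  have no: "\<not> (x extreme_point_of P)" if "x = t *\<^sub>R y" "y \<in> P" "y \<noteq> 0" "0 < t" "t < 1"
    for x y :: 'a and t
  proof -
    have "x \<in> open_segment 0 y" using that by (auto simp: in_segment)
    then show ?thesis using that assms(3) by (auto simp: extreme_point_of_def)
  qed
  have "v \<in> P" "a \<in> P" using assms by (auto simp: extreme_point_of_def)
  consider "c < 1" | "c = 1" | "c > 1" by linarith
  then show False
  proof cases
    case 1
    then show ?thesis using no[OF a \<open>v \<in> P\<close>] assms by blast
  next
    case 2
    then show ?thesis using a assms by simp
  next
    case 3
    then have "v = inverse c *\<^sub>R a" "inverse c < 1" "a \<noteq> 0"
      using a assms by (auto simp: inverse_less_1_iff)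
    then show ?thesis using no[of v "inverse c" a] \<open>a \<in> P\<close> assms by simp
  qed
qed

text \<open>The two open half-planes cover the complement of the closed cone. A point missed by both
  and by the open cone is on the line of \<open>v\<close> or of \<open>w\<close>, hence a negative
  multiple, where the other determinant has the wrong sign.\<close>

lemma not_in_cone_imp:
  assumes "cross2 v w > 0" "\<not> in_cone v w a" "v \<noteq> 0" "w \<noteq> 0" "a \<noteq> 0"
    and "\<And>c. c > 0 \<Longrightarrow> a \<noteq> c *\<^sub>R v" "\<And>c. c > 0 \<Longrightarrow> a \<noteq> c *\<^sub>R w"
  shows "cross2 v a < 0 \<or> cross2 w a > 0"
proof (rule ccontr)
  assume "\<not> ?thesis"
  then have *: "cross2 v a \<ge> 0" "cross2 w a \<le> 0" by auto
  moreover have "\<not> (cross2 v a > 0 \<and> cross2 w a < 0)"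
    using assms(2) by (auto simp: in_cone_def cross2_commute[of w a])
  ultimately consider "cross2 v a = 0" | "cross2 w a = 0" by linarith
  then show False
  proof cases
    case 1
    define c where "c = inner v a / inner v v"
    have a: "a = c *\<^sub>R v" using cross2_eq_0_imp_scaleR[OF assms(3) 1] by (simp add: c_def)
    then have "c < 0" using assms(5) assms(6)[of c] by (metis linorder_neqE scaleR_zero_left)
    have "cross2 w a = (- c) * cross2 v w" by (simp add: a cross2_def algebra_simps)
    also have "\<dots> > 0" using \<open>c < 0\<close> assms(1) by (intro mult_pos_pos) auto
    finally show False using * by simp
  next
    case 2
    define c where "c = inner w a / inner w w"
    have a: "a = c *\<^sub>R w" using cross2_eq_0_imp_scaleR[OF assms(4) 2] by (simp add: c_def)
    then have "c < 0" using assms(5) assms(7)[of c] by (metis linorder_neqE scaleR_zero_left)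
    have "cross2 v a = c * cross2 v w" by (simp add: a cross2_def algebra_simps)
    also have "\<dots> < 0" using \<open>c < 0\<close> assms(1) by (intro mult_neg_pos) auto
    finally show False using * by simp
  qed
qed

text \<open>Otherwise a short move from \<open>v\<close> in both directions orthogonal to
  \<open>w\<close> stays in \<open>P\<close>: a tight constraint is unchanged and the finitely many
  others have slack. Then \<open>v\<close> would be a midpoint. As \<open>w\<close> is arbitrary,
  the result can be used repeatedly to find new tight constraints.\<close>

lemma two_tight_constraints:
  fixes P :: "'a::euclidean_space set"
  assumes dim: "DIM('a) \<ge> 2" and fin: "finite V" and P: "P = {x. \<forall>u\<in>V. inner x u \<ge> -1}"
    and v: "v extreme_point_of P"
  shows "\<not> {u \<in> V. inner v u = -1} \<subseteq> {w}"
proof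
  assume tight: "{u \<in> V. inner v u = -1} \<subseteq> {w}"
  obtain d where d: "d \<noteq> 0" "inner w d = 0"
    using orthogonal_to_vector_exists[OF dim] by (auto simp: orthogonal_def)
  have vP: "\<forall>u\<in>V. inner v u \<ge> -1" using v P by (auto simp: extreme_point_of_def)
  have "\<forall>u\<in>V. \<forall>\<^sub>F e in at_right (0::real). e * \<bar>inner d u\<bar> \<le> inner v u + 1"
  proof
    fix u assume "u \<in> V"
    show "\<forall>\<^sub>F e in at_right (0::real). e * \<bar>inner d u\<bar> \<le> inner v u + 1"
    proof (cases "inner v u = -1")
      case True
      then have "u = w" using tight \<open>u \<in> V\<close> by blast
      then show ?thesis using d True by (simp add: inner_commute)
    next
      case False
      then have "inner v u + 1 > 0" using vP \<open>u \<in> V\<close> by force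
      moreover have "((\<lambda>e::real. e * \<bar>inner d u\<bar>) \<longlongrightarrow> 0) (at_right 0)"
        by (auto intro!: tendsto_eq_intros)
      ultimately have "\<forall>\<^sub>F e in at_right (0::real). e * \<bar>inner d u\<bar> < inner v u + 1"
        by (rule order_tendstoD(2)[rotated])
      then show ?thesis by (rule eventually_mono) simp
    qed
  qed
  then have "\<forall>\<^sub>F e in at_right (0::real). (\<forall>u\<in>V. e * \<bar>inner d u\<bar> \<le> inner v u + 1) \<and> 0 < e"
    using fin by (simp add: eventually_ball_finite eventually_conj eventually_at_right_less)
  then obtain e :: real where e: "\<forall>u\<in>V. e * \<bar>inner d u\<bar> \<le> inner v u + 1" "e > 0"
    using eventually_happens[of _ "at_right (0::real)"] by auto
  have "\<bar>inner (e *\<^sub>R d) u\<bar> \<le> inner v u + 1" if "u \<in> V" for u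
    using e that by (simp add: abs_mult)
  then have "v - e *\<^sub>R d \<in> P" "v + e *\<^sub>R d \<in> P"
    unfolding P by (force simp: inner_diff_left inner_add_left)+
  moreover have "v \<in> open_segment (v - e *\<^sub>R d) (v + e *\<^sub>R d)"
  proof -
    have "v = midpoint (v - e *\<^sub>R d) (v + e *\<^sub>R d)" by (simp add: midpoint_def scaleR_2[symmetric])
    moreover have "v - e *\<^sub>R d \<noteq> v + e *\<^sub>R d"
    proof
      assume "v - e *\<^sub>R d = v + e *\<^sub>R d"
      then have "(2 * e) *\<^sub>R d = 0" by (simp add: algebra_simps scaleR_2[symmetric])
      then show False using d e by simp
    qed
    ultimately show ?thesis by (metis midpoint_in_open_segment)
  qed
  ultimately show False using v by (auto simp: extreme_point_of_def)
qed

lemma no_three_collinear_extreme_points: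
  fixes x y z :: "'a::euclidean_space"
  assumes "x extreme_point_of P" "y extreme_point_of P" "z extreme_point_of P"
    and "x \<noteq> y" "y \<noteq> z" "x \<noteq> z"
  shows "\<not> collinear {x, y, z}"
proof
  assume "collinear {x, y, z}"
  then consider "x \<in> closed_segment y z" | "y \<in> closed_segment z x" | "z \<in> closed_segment x y"
    unfolding collinear_between_cases between_mem_segment by blast
  then show False
    using assms by cases (auto simp: extreme_point_of_def open_segment_def)
qed

lemma collinear_on_line:
  fixes v :: "real^2"
  assumes "v \<noteq> 0" "\<And>x. x \<in> S \<Longrightarrow> inner v x = c"
  shows "collinear S"
proof -
  \<comment> \<open>\<open>?d\<close> is \<open>v\<close> rotated by a right angle, the direction of
    the line.\<close>
  let ?d = "vector [- v$2, v$1] :: real^2"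
  have "x - y = (cross2 v (x - y) / inner v v) *\<^sub>R ?d" if "x \<in> S" "y \<in> S" for x y
  proof -
    have "inner v (x - y) = 0" using that assms(2) by (simp add: inner_diff_right)
    then have "inner v v *\<^sub>R (x - y) = cross2 v (x - y) *\<^sub>R ?d"
      by (auto simp: vec_eq_iff forall_2 cross2_def inner_vec_def sum_2) algebra+
    then have "inverse (inner v v) *\<^sub>R inner v v *\<^sub>R (x - y)
      = inverse (inner v v) *\<^sub>R cross2 v (x - y) *\<^sub>R ?d" by simp
    then show ?thesis using assms(1) by (simp add: divide_inverse mult.commute)
  qed
  then show ?thesis unfolding collinear_def by blast
qed

section \<open>The adjacency graph of a polygon equal to its negated polar\<close>

theorem theorem4p4:
  fixes n :: nat
  assumes "n \<ge> 4" and "even n"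
  shows "\<not> (\<exists>P :: (real ^ 2) set. convex_ngon n P \<and> P = uminus ` polar P)"
proof
  assume "\<exists>P :: (real ^ 2) set. convex_ngon n P \<and> P = uminus ` polar P"
  then obtain P :: "(real^2) set" where ngon: "convex_ngon n P" and dual: "P = uminus ` polar P"
    by blast
  define V where "V = {v. v extreme_point_of P}"
  have cardV: "card V = n" and poly: "polytope P" using ngon by (auto simp: convex_ngon_def V_def)
  \<comment> \<open>An infinite set has \<open>card\<close> equal to 0, which
    \<open>n \<ge> 4\<close> rules out.\<close>
  then have fin: "finite V" using assms(1) by (metis card.infinite not_numeral_le_zero)
  have hull: "P = convex hull V"
    unfolding V_def using poly
    by (intro Krein_Milman_Minkowski) (auto simp: polytope_imp_compact polytope_imp_convex)
  have P_eq: "P = {x. \<forall>a\<in>P. inner x a \<ge> -1}"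
  proof -
    have "x \<in> uminus ` polar P \<longleftrightarrow> (\<forall>a\<in>P. inner x a \<ge> -1)" for x
    proof -
      have "x \<in> uminus ` polar P \<longleftrightarrow> - x \<in> polar P" by (metis image_iff minus_minus)
      then show ?thesis by (auto simp: polar_def)
    qed
    then show ?thesis using dual by blast
  qed
  have P_V: "P = {x. \<forall>u\<in>V. inner x u \<ge> -1}"
  proof -
    have "\<forall>a\<in>P. inner x a \<ge> -1" if "\<forall>u\<in>V. inner x u \<ge> -1" for x
    proof -
      \<comment> \<open>The constraint defined by \<open>x\<close> is a half-space, so it passes
        from the vertices to their hull.\<close>
      have "convex hull V \<subseteq> {a. inner x a \<ge> -1}"
        using that by (intro hull_minimal) (auto simp: convex_halfspace_ge)
      then show ?thesis using hull by auto
    qed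
    moreover have "V \<subseteq> P" by (auto simp: V_def extreme_point_of_def)
    ultimately show ?thesis using P_eq by blast
  qed
  have V_P: "V \<subseteq> P" and ext: "\<And>v. v \<in> V \<Longrightarrow> v extreme_point_of P"
    by (auto simp: V_def extreme_point_of_def)
  have ge: "inner a b \<ge> -1" if "a \<in> V" "b \<in> V" for a b
    using that V_P P_V by blast
  have "0 \<in> P" by (subst P_V) simp
  have tight: "\<not> {u \<in> V. inner v u = -1} \<subseteq> {w}" if "v \<in> V" for v w
    using two_tight_constraints[OF _ fin P_V ext[OF that]] by simp
  \<comment> \<open>At \<open>v = 0\<close> no constraint would be tight.\<close>
  have nz: "v \<noteq> 0" if "v \<in> V" for v
    using tight[OF that] by force
  have ray: "a \<noteq> c *\<^sub>R v" if "v \<in> V" "a \<in> V" "a \<noteq> v" "c > 0" for v a c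
    using extreme_points_not_on_ray[OF ext ext \<open>0 \<in> P\<close>] that nz by blast
  define E where "E v w \<longleftrightarrow> inner v w = -1" for v w :: "real^2"
  have sym: "E b a" if "E a b" for a b using that by (simp add: E_def inner_commute)
  have irr: "\<not> E a a" for a by (simp add: E_def) (smt (verit) inner_ge_zero)
  have reg: "card {b \<in> V. E v b} = 2" if v: "v \<in> V" for v
  proof -
    \<comment> \<open>Excluding \<open>0\<close> gives a first neighbour and excluding
      \<open>x\<close> a second; a third would be collinear with them on the line
      \<open>inner v z = -1\<close>.\<close>
    obtain x where x: "x \<in> V" "E v x" using tight[OF v, of 0] by (auto simp: E_def)
    obtain y where y: "y \<in> V" "E v y" "y \<noteq> x" using tight[OF v, of x] by (auto simp: E_def)
    have "z = x \<or> z = y" if z: "z \<in> V" "E v z" for z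
    proof (rule ccontr)
      assume "\<not> ?thesis"
      then have "\<not> collinear {x, y, z}"
        using no_three_collinear_extreme_points[OF ext ext ext] x y z by metis
      moreover have "collinear {x, y, z}"
        using x y z nz[OF v] by (intro collinear_on_line[of v _ "-1"]) (auto simp: E_def)
      ultimately show False by blast
    qed
    then have "{b \<in> V. E v b} = {x, y}" using x y by auto
    then show ?thesis using y by auto
  qed
  \<comment> \<open>Stated for every positively oriented edge, since \<open>side\<close> applies it
    to edges other than the chosen one.\<close>
  have cross: "in_cone v w a \<longleftrightarrow> \<not> in_cone v w b"
    if "v \<in> V" "w \<in> V" "E v w" "cross2 v w > 0" "a \<in> V - {v, w}" "b \<in> V - {v, w}" "E a b"
    for v w a b
  proof -
    have eqs: "inner v w = -1" "inner a b = -1" using that by (auto simp: E_def)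
    have ges: "inner v a \<ge> -1" "inner v b \<ge> -1" "inner w a \<ge> -1" "inner w b \<ge> -1"
      using ge that by auto
    have out: "cross2 v u < 0 \<or> cross2 w u > 0" if "u \<in> V - {v, w}" "\<not> in_cone v w u" for u
      using that \<open>v \<in> V\<close> \<open>w \<in> V\<close> \<open>cross2 v w > 0\<close> nz ray
      by (intro not_in_cone_imp) blast+
    show ?thesis
      using not_both_in_cone[OF \<open>cross2 v w > 0\<close> eqs ges]
        not_both_outside_cone[OF \<open>cross2 v w > 0\<close> eqs ges] out that by blast
  qed
  obtain v w where vw: "v \<in> V" "w \<in> V" "E v w" "cross2 v w > 0"
  proof -
    have "V \<noteq> {}" using cardV assms(1) by auto
    then obtain v where v: "v \<in> V" by blast
    \<comment> \<open>The excluded point is the only one on the line through \<open>0\<close> and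
      \<open>v\<close> with inner product -1 with \<open>v\<close>, so \<open>w\<close> is not
      parallel to \<open>v\<close>; swapping the ends if necessary fixes the orientation.\<close>
    obtain w where w: "w \<in> V" "E v w" "w \<noteq> (- 1 / inner v v) *\<^sub>R v"
      using tight[OF v, of "(- 1 / inner v v) *\<^sub>R v"] by (auto simp: E_def)
    then have "cross2 v w \<noteq> 0"
      using cross2_eq_0_imp_scaleR[of v w] nz[OF v] by (auto simp: E_def)
    then consider "cross2 v w > 0" | "cross2 w v > 0"
      using cross2_commute[of v w] by linarith
    then show ?thesis using that v w sym by cases auto
  qed
  have side: "in_cone v w a \<longleftrightarrow> in_cone v w b"
    if a: "a \<in> V - {v, w}" and b: "b \<in> V - {v, w}" and E: "E v a" "E w b" for a b
  proof (cases "a = b")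
    case False
    \<comment> \<open>Shrinking a cone by moving one spanning ray inwards: positivity follows from
      the three-term Pluecker relation, as in \<open>sub'\<close>.\<close>
    have sub: "in_cone v w u" if "in_cone v a u" "in_cone v w a" for u
    proof -
      have "cross2 v a * cross2 u w = cross2 v w * cross2 u a + cross2 v u * cross2 a w"
        by (simp add: cross2_def algebra_simps)
      also have "\<dots> > 0" using that vw by (simp add: in_cone_def add_pos_pos)
      finally show ?thesis using that by (auto simp: in_cone_def zero_less_mult_iff)
    qed
    have sub': "in_cone v w u" if "in_cone b w u" "in_cone v w b" for u
    proof -
      have "cross2 b w * cross2 v u = cross2 v w * cross2 b u + cross2 u w * cross2 v b"
        by (simp add: cross2_def algebra_simps)
      also have "\<dots> > 0" using that vw by (simp add: in_cone_def add_pos_pos)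
      finally show ?thesis using that by (auto simp: in_cone_def zero_less_mult_iff)
    qed
    show ?thesis
    proof
      \<comment> \<open>The edges \<open>{v, a}\<close> and \<open>{w, b}\<close> are disjoint,
        hence cross. As \<open>w\<close> is outside the cone of \<open>v\<close> and
        \<open>a\<close>, \<open>b\<close> is inside it, and thus inside the larger cone of
        \<open>v\<close> and \<open>w\<close>. The converse is the mirror image.\<close>
      assume C: "in_cone v w a"
      then have "\<not> in_cone v a w" using cross2_commute[of a w] by (simp add: in_cone_def)
      then have "in_cone v a b"
        using cross[of v a w b] a b vw E C False by (auto simp: in_cone_def)
      then show "in_cone v w b" using sub C by blast
    next
      assume C: "in_cone v w b"
      then have "\<not> in_cone b w v" using cross2_commute[of b v] by (simp add: in_cone_def)
      then have "in_cone b w a"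
        using cross[of b w v a] a b vw E C False sym by (auto simp: in_cone_def)
      then show "in_cone v w a" using sub' C by blast
    qed
  qed simp
  have "odd (card V)"
    by (rule odd_card_two_regular[OF fin sym irr reg vw(1-3) cross[OF vw] side])
  then show False using cardV assms(2) by simp
qed

end
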